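(* Consider $F=f+g$ and let the (possibly random) iterates $\mathbf{x}^1,\dots,\mathbf{x}^K$ be generated by the Proximal Arbitrary-Block Descent Method described in the context, from an initial point $\mathbf{x}^0\in\mathrm{dom}(g)$ and an arbitrary sequence $S_0,\dots,S_{K-1}$ of non-empty (possibly random) subsets of $[n]$. Let $\epsilon>0$ be fixed and let $$\mu_k:=\frac{\mathbf{E}[\xi(\mathbf{x}^k)\,\theta(S_k,\mathbf{x}^k)]}{\mathbf{E}[\xi(\mathbf{x}^k)]}.$$ If the inequality $$\frac{\xi(\mathbf{x}^0)}{\epsilon}\log\left(\frac{\xi(\mathbf{x}^0)}{\epsilon}\right)\le\sum_{k=0}^{K-1}\mu_k$$ holds, then at least one of the following conclusions holds: (i) $\lambda(\mathbf{x}^k)<\epsilon$ for at least one $k\in\{0,\dots,K-1\}$; (ii) $\mathbf{E}[\xi(\mathbf{x}^K)]\le\epsilon$.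
   Context: Notation: $[n]=\{1,\dots,n\}$, $\bar{\mathbb{R}}=\mathbb{R}\cup\{+\infty\}$, $\|\cdot\|$ Euclidean norm, $\mathbf{E}$ expectation over the whole block-selection process. For $\emptyset\ne S\subseteq[n]$, $\mathbf{x}_{[S]}\in\mathbb{R}^n$ is $\mathbf{x}$ with entries outside $S$ set to zero, and $\mathbf{M}_{[S]}\in\mathbb{R}^{n\times n}$ is $\mathbf{M}$ with all entries outside the rows and columns in $S$ set to zero. Setup: $f:\mathbb{R}^n\to\mathbb{R}$ is differentiable and $\mathbf{M}$-smooth for a positive definite matrix $\mathbf{M}$: $f(\mathbf{x}+\mathbf{h})\le f(\mathbf{x})+\langle\nabla f(\mathbf{x}),\mathbf{h}\rangle+\frac12\langle\mathbf{M}\mathbf{h},\mathbf{h}\rangle$ for all $\mathbf{x},\mathbf{h}\in\mathbb{R}^n$. $g:\mathbb{R}^n\to\bar{\mathbb{R}}$ is separable: $g(\mathbf{x})=\sum_{i=1}^n g_i(x_i)$ with scalar functions $g_i:\mathbb{R}\to\bar{\mathbb{R}}$. $F=f+g$ has a global minimizer $\mathbf{x}^*$ with $F(\mathbf{x}^* )>-\infty$. Standing convention: either $g=0$ (smooth case; $\mathbf{M}$ arbitrary positive definite), or $g\neq 0$ and $\mathbf{M}=L\mathbf{I}$ for some $L>0$. In general $L>0$ denotes a constant such that $f$ is $L\mathbf{I}$-smooth (with $\mathbf{M}=L\mathbf{I}$ when $g\neq0$; when $g=0$ the quantities below do not depend on the choice of $L$). Define $U_S(\mathbf{x},\mathbf{u}):=\langle(\nabla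 f(\mathbf{x}))_{[S]},\mathbf{u}\rangle+\frac12\mathbf{u}^\top\mathbf{M}_{[S]}\mathbf{u}+\sum_{i\in S}[g_i(x_i+u_i)-g_i(x_i)]$. Algorithm (Proximal Arbitrary-Block Descent Method): for $k=0,\dots,K-1$, pick a non-empty $S_k\subseteq[n]$ by an arbitrary (deterministic or random, possibly history-dependent) procedure, choose $\mathbf{u}^k\in\operatorname{argmin}_{\mathbf{u}}U_{S_k}(\mathbf{x}^k,\mathbf{u})$, and set $\mathbf{x}^{k+1}=\mathbf{x}^k+\mathbf{u}^k_{[S_k]}$. The minima involved are assumed to be attained. Functions: optimality gap $\xi(\mathbf{x}):=F(\mathbf{x})-F(\mathbf{x}^* )$; $\lambda(\mathbf{x}):=-L\cdot\min_{\mathbf{y}\in\mathbb{R}^n}\{\langle\nabla f(\mathbf{x}),\mathbf{y}\rangle+\frac L2\|\mathbf{y}\|^2+g(\mathbf{x}+\mathbf{y})-g(\mathbf{x})\}$ (equal to $\frac12\|\nabla f(\mathbf{x})\|^2$ if $g=0$); proportion function $\theta(S,\mathbf{x}):=\frac{-\min_{\mathbf{u}\in\mathbb{R}^n}U_S(\mathbf{x},\mathbf{u})}{\lambda(\mathbf{x})}$ if $\lambda(\mathbf{x})\neq0$, and $\theta(S,\mathbf{x}):=0$ if $\lambda(\mathbf{x})=0$. *)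

theory Defs
  imports "HOL-Probability.Probability"
begin

definition gradient :: "(real^'n \<Rightarrow> real) \<Rightarrow> real^'n \<Rightarrow> real^'n" where
  "gradient f x = (THE d. GDERIV f x :> d)"

definition positive_definite :: "real^'n^'n \<Rightarrow> bool" where
  "positive_definite M \<longleftrightarrow> transpose M = M \<and> (\<forall>x. x \<noteq> 0 \<longrightarrow> (M *v x) \<bullet> x > 0)"

definition matrix_smooth :: "real^'n^'n \<Rightarrow> (real^'n \<Rightarrow> real) \<Rightarrow> bool" where
  "matrix_smooth M f \<longleftrightarrow>
     (\<forall>x h. f (x + h) \<le> f x + gradient f x \<bullet> h + 1/2 * ((M *v h) \<bullet> h))"

definition block_vec :: "'n set \<Rightarrow> real^'n \<Rightarrow> real^'n" where
  "block_vec S x = (\<chi> i. if i \<in> S then x $ i else 0)"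

definition block_mat :: "'n set \<Rightarrow> real^'n^'n \<Rightarrow> real^'n^'n" where
  "block_mat S M = (\<chi> i j. if i \<in> S \<and> j \<in> S then M $ i $ j else 0)"

definition separable_sum :: "('n \<Rightarrow> real \<Rightarrow> ereal) \<Rightarrow> real^'n \<Rightarrow> ereal" where
  "separable_sum g x = (\<Sum>i\<in>UNIV. g i (x $ i))"

definition objective :: "(real^'n \<Rightarrow> real) \<Rightarrow> ('n \<Rightarrow> real \<Rightarrow> ereal) \<Rightarrow> real^'n \<Rightarrow> ereal" where
  "objective f g x = ereal (f x) + separable_sum g x"

text \<open>The differences of extended reals below are meaningful only at points \<open>x\<close> where
  \<open>separable_sum g x\<close> is finite; in \<open>ereal\<close>, \<open>\<infinity> - \<infinity> = \<infinity>\<close>. The minima are written as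
  infima, which are their values whenever they are attained.\<close>

definition block_model ::
  "real^'n^'n \<Rightarrow> (real^'n \<Rightarrow> real) \<Rightarrow> ('n \<Rightarrow> real \<Rightarrow> ereal) \<Rightarrow> 'n set \<Rightarrow> real^'n \<Rightarrow> real^'n \<Rightarrow> ereal" where
  "block_model M f g S x u =
     ereal (block_vec S (gradient f x) \<bullet> u + 1/2 * (u \<bullet> (block_mat S M *v u)))
     + (\<Sum>i\<in>S. g i (x $ i + u $ i) - g i (x $ i))"

definition full_model ::
  "real \<Rightarrow> (real^'n \<Rightarrow> real) \<Rightarrow> ('n \<Rightarrow> real \<Rightarrow> ereal) \<Rightarrow> real^'n \<Rightarrow> real^'n \<Rightarrow> ereal" where
  "full_model L f g x y =
     ereal (gradient f x \<bullet> y + L/2 * (norm y)\<^sup>2)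
     + (separable_sum g (x + y) - separable_sum g x)"

definition gap ::
  "(real^'n \<Rightarrow> real) \<Rightarrow> ('n \<Rightarrow> real \<Rightarrow> ereal) \<Rightarrow> real^'n \<Rightarrow> real^'n \<Rightarrow> real" where
  "gap f g xstar x = real_of_ereal (objective f g x - objective f g xstar)"

definition lam ::
  "real \<Rightarrow> (real^'n \<Rightarrow> real) \<Rightarrow> ('n \<Rightarrow> real \<Rightarrow> ereal) \<Rightarrow> real^'n \<Rightarrow> real" where
  "lam L f g x = - L * real_of_ereal (INF y. full_model L f g x y)"

definition proportion ::
  "real \<Rightarrow> real^'n^'n \<Rightarrow> (real^'n \<Rightarrow> real) \<Rightarrow> ('n \<Rightarrow> real \<Rightarrow> ereal) \<Rightarrow> 'n set \<Rightarrow> real^'n \<Rightarrow> real" where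
  "proportion L M f g S x =
     (if lam L f g x \<noteq> 0
      then - real_of_ereal (INF u. block_model M f g S x u) / lam L f g x
      else 0)"

text \<open>A single sample path; the blocks \<open>S k\<close> and the choices among the minimizers are
  unrestricted, so they may depend on the history.\<close>

definition pabd_run ::
  "real^'n^'n \<Rightarrow> (real^'n \<Rightarrow> real) \<Rightarrow> ('n \<Rightarrow> real \<Rightarrow> ereal) \<Rightarrow> nat \<Rightarrow> real^'n
   \<Rightarrow> (nat \<Rightarrow> 'n set) \<Rightarrow> (nat \<Rightarrow> real^'n) \<Rightarrow> (nat \<Rightarrow> real^'n) \<Rightarrow> bool" where
  "pabd_run M f g K x0 S u x \<longleftrightarrow>
     x 0 = x0 \<and>
     (\<forall>k<K. S k \<noteq> {} \<and>
            is_arg_min (block_model M f g (S k) (x k)) (\<lambda>_. True) (u k) \<and>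
            x (Suc k) = x k + block_vec (S k) (u k))"

end

theory Submission
  imports Defs
begin

text \<open>
  Minimizing the block model decreases the objective by at least
  \<open>\<theta>(S\<^sub>k, x\<^sup>k) \<lambda>(x\<^sup>k)\<close>, on every sample path. If \<open>\<lambda>(x\<^sup>k) \<ge> \<epsilon>\<close> almost surely
  for all \<open>k < K\<close>, then \<open>\<xi>(x\<^sup>k) \<le> \<xi>(x\<^sup>0)\<close> gives
  \<open>\<xi>(x\<^sup>k\<^sup>+\<^sup>1) \<le> \<xi>(x\<^sup>k) - (\<epsilon> / \<xi>(x\<^sup>0)) \<xi>(x\<^sup>k) \<theta>(S\<^sub>k, x\<^sup>k)\<close>. In expectation the gap
  therefore contracts by \<open>1 - \<epsilon> \<mu>\<^sub>k / \<xi>(x\<^sup>0) \<le> exp (- \<epsilon> \<mu>\<^sub>k / \<xi>(x\<^sup>0))\<close> in step \<open>k\<close>,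
  and the assumed lower bound on \<open>\<Sum> \<mu>\<^sub>k\<close> makes the product of these factors at most
  \<open>\<epsilon> / \<xi>(x\<^sup>0)\<close>.
\<close>

section \<open>Blocks, extended-real sums and attained minima\<close>

lemma inner_block_vec_left: "block_vec S a \<bullet> u = a \<bullet> block_vec S u"
  unfolding inner_vec_def block_vec_def by (auto intro!: sum.cong)

text \<open>With \<open>inner_block_vec_left\<close>, this matches the smooth part of
  \<open>block_model\<close> at \<open>u\<close> with the bound of \<open>matrix_smooth\<close> for
  the displacement \<open>block_vec S u\<close>.\<close>

lemma block_mat_quadratic_form:
  "u \<bullet> (block_mat S M *v u) = (M *v block_vec S u) \<bullet> block_vec S u"
  by (auto simp: inner_vec_def matrix_vector_mult_def block_mat_def block_vec_def
      sum_distrib_left sum_distrib_right mult_ac intro!: sum.cong)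

lemma ereal_sum_less_infinity_iff:
  fixes h :: "'a \<Rightarrow> ereal"
  assumes "finite A" "\<And>i. i \<in> A \<Longrightarrow> h i \<noteq> -\<infinity>"
  shows "sum h A < \<infinity> \<longleftrightarrow> (\<forall>i\<in>A. h i \<noteq> \<infinity>)"
  using assms sum_Pinfty[of h A] by (auto simp: less_top[symmetric] top_ereal_def)

lemma objective_finite:
  assumes "\<And>i. \<bar>g i (x $ i)\<bar> \<noteq> \<infinity>"
  shows "objective f g x = ereal (f x + (\<Sum>i\<in>UNIV. real_of_ereal (g i (x $ i))))"
proof -
  have "separable_sum g x = (\<Sum>i\<in>UNIV. ereal (real_of_ereal (g i (x $ i))))"
    unfolding separable_sum_def by (intro sum.cong refl) (simp add: ereal_real assms)
  then show ?thesis by (simp add: objective_def)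
qed

lemma INF_eq_arg_min:
  fixes h :: "'a \<Rightarrow> ereal"
  assumes "is_arg_min h (\<lambda>_. True) u"
  shows "(INF v. h v) = h u"
  using assms by (intro antisym INF_lower INF_greatest) (auto simp: is_arg_min_def not_less)

section \<open>One block step and the optimality gap\<close>

text \<open>The zero step has model value 0, so a minimizer has value at most 0 and cannot leave the
  domain. Smoothness bounds the change of \<open>f\<close>, and separability makes the change of the
  other term exactly its part in the model.\<close>

lemma block_step:
  assumes smooth: "matrix_smooth M f"
    and g_values: "\<And>i t. g i t \<noteq> -\<infinity>"
    and dom: "\<And>i. \<bar>g i (x $ i)\<bar> \<noteq> \<infinity>"
    and min: "is_arg_min (block_model M f g S x) (\<lambda>_. True) u"
  defines "x' \<equiv> x + block_vec S u" and "m \<equiv> real_of_ereal (INF v. block_model M f g S x v)"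
  shows "\<And>i. \<bar>g i (x' $ i)\<bar> \<noteq> \<infinity>" "m \<le> 0"
    "real_of_ereal (objective f g x') \<le> real_of_ereal (objective f g x) + m"
proof -
  let ?U = "block_model M f g S x"
  let ?q = "block_vec S (gradient f x) \<bullet> u + 1/2 * (u \<bullet> (block_mat S M *v u))"
  let ?d = "\<lambda>i. g i (x $ i + u $ i) - g i (x $ i)"
  define r where "r i = real_of_ereal (g i (x $ i))" for i
  define r' where "r' i = real_of_ereal (g i (x' $ i))" for i
  have r: "g i (x $ i) = ereal (r i)" for i
    using dom[of i] by (simp add: r_def ereal_real)
  have zero: "?U 0 = 0"
    by (simp add: block_model_def r zero_ereal_def[symmetric])
  with min have le0: "?U u \<le> 0"
    by (metis is_arg_min_def not_less)
  have fin_S: "g i (x $ i + u $ i) \<noteq> \<infinity>" if "i \<in> S" for i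
  proof -
    \<comment> \<open>Finiteness at \<open>x\<close> excludes the value -\<infinity>, so a sum below
      \<infinity> will force every summand below \<infinity>.\<close>
    have d_values: "?d i \<noteq> -\<infinity>" for i
      using g_values[of i "x $ i + u $ i"] by (cases "g i (x $ i + u $ i)") (auto simp: r)
    have "sum ?d S < \<infinity>"
      using le0 unfolding block_model_def by (cases "sum ?d S") auto
    then have "?d i \<noteq> \<infinity>"
      using ereal_sum_less_infinity_iff[of S ?d] d_values that by auto
    then show ?thesis by (auto simp: r)
  qed
  show dom': "\<bar>g i (x' $ i)\<bar> \<noteq> \<infinity>" for i
    using fin_S[of i] g_values dom[of i]
    by (cases "i \<in> S") (auto simp: x'_def block_vec_def)
  have r': "g i (x' $ i) = ereal (r' i)" for i
    using dom'[of i] by (simp add: r'_def ereal_real)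
  have "g i (x $ i + u $ i) = ereal (r' i)" if "i \<in> S" for i
    using r'[of i] that by (simp add: x'_def block_vec_def)
  then have "sum ?d S = (\<Sum>i\<in>S. ereal (r' i - r i))"
    by (intro sum.cong refl) (simp add: r)
  then have U: "?U u = ereal (?q + (\<Sum>i\<in>S. r' i - r i))"
    by (simp add: block_model_def)
  then have m: "m = ?q + (\<Sum>i\<in>S. r' i - r i)"
    by (simp add: m_def INF_eq_arg_min[OF min])
  show "m \<le> 0"
    using le0 U by (simp add: m)
  \<comment> \<open>Coordinates outside \<open>S\<close> do not move, so the sum over the block is
    the full change of the separable term.\<close>
  have "r' i = r i" if "i \<notin> S" for i
    using that by (simp add: r_def r'_def x'_def block_vec_def)
  then have "(\<Sum>i\<in>S. r' i - r i) = (\<Sum>i\<in>UNIV. r' i - r i)"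
    by (intro sum.mono_neutral_left) auto
  moreover have "f x' \<le> f x + ?q"
    using smooth unfolding matrix_smooth_def x'_def
    by (simp add: inner_block_vec_left block_mat_quadratic_form add.assoc)
  ultimately show "real_of_ereal (objective f g x') \<le> real_of_ereal (objective f g x) + m"
    using objective_finite[of g x f] objective_finite[of g x' f] dom dom'
    by (simp add: m r_def r'_def sum_subtractf)
qed

text \<open>\<open>real_of_ereal\<close> respects subtraction only between finite values; from here
  on the gap can be treated by real arithmetic.\<close>

lemma gap_finite:
  assumes "\<And>i. \<bar>g i (x $ i)\<bar> \<noteq> \<infinity>" "\<bar>objective f g xstar\<bar> \<noteq> \<infinity>"
  shows "gap f g xstar x = real_of_ereal (objective f g x) - real_of_ereal (objective f g xstar)"
  using objective_finite[of g x f] assms by (cases "objective f g xstar") (auto simp: gap_def)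

lemma gap_nonneg:
  assumes "\<And>i. \<bar>g i (x $ i)\<bar> \<noteq> \<infinity>" "\<bar>objective f g xstar\<bar> \<noteq> \<infinity>"
    and "is_arg_min (objective f g) (\<lambda>_. True) xstar"
  shows "0 \<le> gap f g xstar x"
proof -
  have "objective f g xstar \<le> objective f g x"
    using assms(3) by (auto simp: is_arg_min_def not_less)
  then show ?thesis
    using objective_finite[of g x f] assms(1,2)
    by (cases "objective f g xstar") (auto simp: gap_def)
qed

section \<open>Contraction of the expected gap\<close>

text \<open>Iterates 1 + t \<le> exp t, which holds for every real t, so the factors
  \<open>1 - c * \<mu> k\<close> may be negative.\<close>

lemma exp_decay:
  fixes E \<mu> :: "nat \<Rightarrow> real"
  assumes "\<And>k. k < K \<Longrightarrow> E (Suc k) \<le> (1 - c * \<mu> k) * E k"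
    and "\<And>k. k < K \<Longrightarrow> 0 \<le> E k"
  shows "E K \<le> exp (- c * (\<Sum>k<K. \<mu> k)) * E 0"
  using assms
proof (induction K)
  case (Suc K)
  have "E (Suc K) \<le> (1 - c * \<mu> K) * E K" using Suc.prems by simp
  also have "\<dots> \<le> exp (- c * \<mu> K) * E K"
    using exp_ge_add_one_self[of "- c * \<mu> K"] Suc.prems(2)[of K]
    by (intro mult_right_mono) auto
  also have "\<dots> \<le> exp (- c * \<mu> K) * (exp (- c * (\<Sum>k<K. \<mu> k)) * E 0)"
    using Suc by (intro mult_left_mono) auto
  also have "\<dots> = exp (- c * (\<Sum>k<Suc K. \<mu> k)) * E 0"
    by (simp add: algebra_simps flip: exp_add)
  finally show ?case .
qed simp

text \<open>The division in the budget may be by zero. This is harmless: if \<open>X k\<close> has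
  expectation zero, then so has \<open>X (Suc k)\<close>.\<close>

lemma (in prob_space) expected_gap_bound:
  fixes X \<theta> :: "nat \<Rightarrow> 'a \<Rightarrow> real"
  assumes X0: "\<And>\<omega>. \<omega> \<in> space M \<Longrightarrow> X 0 \<omega> = a"
    and X_meas: "\<And>k. k \<le> K \<Longrightarrow> X k \<in> borel_measurable M"
    and X_nonneg: "\<And>k \<omega>. k \<le> K \<Longrightarrow> \<omega> \<in> space M \<Longrightarrow> 0 \<le> X k \<omega>"
    and X_decreasing: "\<And>k \<omega>. k < K \<Longrightarrow> \<omega> \<in> space M \<Longrightarrow> X (Suc k) \<omega> \<le> X k \<omega>"
    and X\<theta>_meas: "\<And>k. k < K \<Longrightarrow> (\<lambda>\<omega>. X k \<omega> * \<theta> k \<omega>) \<in> borel_measurable M"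
    and step: "\<And>k. k < K \<Longrightarrow> AE \<omega> in M. 0 \<le> \<theta> k \<omega> \<and> X (Suc k) \<omega> \<le> X k \<omega> - \<epsilon> * \<theta> k \<omega>"
    and eps_pos: "\<epsilon> > 0"
    and budget: "a / \<epsilon> * ln (a / \<epsilon>)
        \<le> (\<Sum>k<K. expectation (\<lambda>\<omega>. X k \<omega> * \<theta> k \<omega>) / expectation (X k))"
  shows "expectation (X K) \<le> \<epsilon>"
proof -
  obtain \<omega>\<^sub>0 where "\<omega>\<^sub>0 \<in> space M" using not_empty by blast
  then have a_nonneg: "0 \<le> a" using X0 X_nonneg[of 0] by force
  have X_le: "X k \<omega> \<le> a" if "k \<le> K" "\<omega> \<in> space M" for k \<omega>
    using that(1)
  proof (induction k)
    case (Suc k)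
    then show ?case using X_decreasing[of k \<omega>] that(2) by force
  qed (simp add: X0 that(2))
  have X_int: "integrable M (X k)" if "k \<le> K" for k
    using that X_le X_nonneg X_meas
    by (intro integrable_const_bound[where B = a]) auto
  have E0: "expectation (X 0) = a"
    using Bochner_Integration.integral_cong[of M M "X 0" "\<lambda>_. a"] X0 by (simp add: prob_space)
  show ?thesis
  \<comment> \<open>The rate below divides by \<open>a\<close>; for \<open>a = 0\<close> every
    \<open>X k\<close> vanishes on the space.\<close>
  proof (cases "a = 0")
    case True
    then have "expectation (X K) \<le> expectation (\<lambda>_. 0)"
      using X_le X_int by (intro integral_mono) auto
    then show ?thesis using eps_pos by simp
  next
    case False
    with a_nonneg have a_pos: "a > 0" by simp
    \<comment> \<open>As \<open>X k \<omega> \<le> a\<close>, this rate gives \<open>c * (X k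
      \<omega> * \<theta> k \<omega>) \<le> \<epsilon> * \<theta> k \<omega>\<close>, which replaces
      the guaranteed decrease by a multiple of the product averaged in the budget.\<close>
    define c where "c = \<epsilon> / a"
    have c_pos: "c > 0" using a_pos eps_pos by (simp add: c_def)
    define \<mu> where "\<mu> k = expectation (\<lambda>\<omega>. X k \<omega> * \<theta> k \<omega>) / expectation (X k)" for k
    have "expectation (X (Suc k)) \<le> (1 - c * \<mu> k) * expectation (X k)" if k: "k < K" for k
    proof -
      have pointwise: "AE \<omega> in M. 0 \<le> X k \<omega> * \<theta> k \<omega> \<and> X (Suc k) \<omega> \<le> X k \<omega> - c * (X k \<omega> * \<theta> k \<omega>)"
        using step[OF k] AE_space
      proof eventually_elim
        case (elim \<omega>)
        have "X k \<omega> * \<theta> k \<omega> \<le> a * \<theta> k \<omega>" "0 \<le> X k \<omega>"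
          using X_le[of k \<omega>] X_nonneg[of k \<omega>] k elim by (auto intro: mult_right_mono)
        moreover from this have "c * (X k \<omega> * \<theta> k \<omega>) \<le> c * (a * \<theta> k \<omega>)"
          using c_pos by simp
        moreover have "c * (a * \<theta> k \<omega>) = \<epsilon> * \<theta> k \<omega>"
          using a_pos by (simp add: c_def)
        ultimately show ?case using elim by auto
      qed
      have X\<theta>_int: "integrable M (\<lambda>\<omega>. X k \<omega> * \<theta> k \<omega>)"
      \<comment> \<open>The bound comes from the decrease itself: a nonnegative gap that is at most
        \<open>a\<close> cannot drop by more than \<open>a\<close>. No separate bound on
        \<open>\<theta>\<close> enters.\<close>
      proof (rule integrable_const_bound[where B = "a / c"])
        show "AE \<omega> in M. norm (X k \<omega> * \<theta> k \<omega>) \<le> a / c"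
          using pointwise AE_space
        proof eventually_elim
          case (elim \<omega>)
          then have "c * (X k \<omega> * \<theta> k \<omega>) \<le> a"
            using X_le[of k \<omega>] X_nonneg[of "Suc k" \<omega>] k by auto
          then show ?case using elim c_pos by (simp add: field_simps abs_of_nonneg)
        qed
      qed (rule X\<theta>_meas[OF k])
      have E_nonneg: "0 \<le> expectation (\<lambda>\<omega>. X k \<omega> * \<theta> k \<omega>)"
        using pointwise by (intro integral_nonneg_AE) auto
      have "expectation (X (Suc k)) \<le> expectation (\<lambda>\<omega>. X k \<omega> - c * (X k \<omega> * \<theta> k \<omega>))"
        using pointwise X_int[of k] X_int[of "Suc k"] X\<theta>_int k by (intro integral_mono_AE) auto
      also have "\<dots> = expectation (X k) - c * expectation (\<lambda>\<omega>. X k \<omega> * \<theta> k \<omega>)"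
        using X_int[of k] X\<theta>_int k by simp
      \<comment> \<open>An equality if the expectation is nonzero. Otherwise the right side is 0 and
        \<open>E_nonneg\<close> makes the left side at most 0.\<close>
      also have "\<dots> \<le> (1 - c * \<mu> k) * expectation (X k)"
        using E_nonneg c_pos by (cases "expectation (X k) = 0") (auto simp: \<mu>_def algebra_simps)
      finally show ?thesis .
    qed
    moreover have "0 \<le> expectation (X k)" if "k < K" for k
      using that X_nonneg by (intro Bochner_Integration.integral_nonneg) auto
    ultimately have "expectation (X K) \<le> exp (- c * (\<Sum>k<K. \<mu> k)) * a"
      using exp_decay[of K "\<lambda>k. expectation (X k)" c \<mu>] E0 by simp
    also have "\<dots> \<le> exp (- ln (a / \<epsilon>)) * a"
    proof -
      have "c * (a / \<epsilon> * ln (a / \<epsilon>)) \<le> c * (\<Sum>k<K. \<mu> k)"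
        using budget c_pos unfolding \<mu>_def by (intro mult_left_mono) auto
      moreover have "c * (a / \<epsilon> * ln (a / \<epsilon>)) = ln (a / \<epsilon>)"
        using a_pos eps_pos by (simp add: c_def)
      ultimately show ?thesis using a_pos by simp
    qed
    also have "\<dots> = \<epsilon>" using a_pos eps_pos by (simp add: exp_minus)
    finally show ?thesis .
  qed
qed

section \<open>Application to the random iterates\<close>

theorem theorem20:
  fixes f :: "real^'n \<Rightarrow> real" and g :: "'n \<Rightarrow> real \<Rightarrow> ereal"
    and M :: "real^'n^'n" and L \<epsilon> :: real and K :: nat
    and xstar x0 :: "real^'n"
    and P :: "'w measure"
    and S :: "nat \<Rightarrow> 'w \<Rightarrow> 'n set" and u x :: "nat \<Rightarrow> 'w \<Rightarrow> real^'n"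
  assumes f_differentiable: "\<And>y. f differentiable (at y)"
    and M_posdef: "positive_definite M"
    and M_smooth: "matrix_smooth M f"
    and L_pos: "L > 0"
    and L_smooth: "matrix_smooth (mat L) f"
    and g_values: "\<And>i t. g i t \<noteq> -\<infinity>"
    and convention: "separable_sum g = (\<lambda>_. 0) \<or> (separable_sum g \<noteq> (\<lambda>_. 0) \<and> M = mat L)"
    and xstar_min: "is_arg_min (objective f g) (\<lambda>_. True) xstar"
    and xstar_bounded: "objective f g xstar > -\<infinity>"
    and x0_dom: "separable_sum g x0 < \<infinity>"
    and P_prob: "prob_space P"
    and S_random: "\<And>k. k < K \<Longrightarrow> S k \<in> measurable P (count_space UNIV)"
    and algorithm: "\<And>\<omega>. \<omega> \<in> space P \<Longrightarrow>
          pabd_run M f g K x0 (\<lambda>k. S k \<omega>) (\<lambda>k. u k \<omega>) (\<lambda>k. x k \<omega>)"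
    and lam_attained: "\<And>k \<omega>. k < K \<Longrightarrow> \<omega> \<in> space P \<Longrightarrow>
          \<exists>y. is_arg_min (full_model L f g (x k \<omega>)) (\<lambda>_. True) y"
    and gap_random: "\<And>k. k \<le> K \<Longrightarrow> (\<lambda>\<omega>. gap f g xstar (x k \<omega>)) \<in> borel_measurable P"
    and gap_proportion_random: "\<And>k. k < K \<Longrightarrow>
          (\<lambda>\<omega>. gap f g xstar (x k \<omega>) * proportion L M f g (S k \<omega>) (x k \<omega>)) \<in> borel_measurable P"
    and eps_pos: "\<epsilon> > 0"
    and budget: "gap f g xstar x0 / \<epsilon> * ln (gap f g xstar x0 / \<epsilon>)
          \<le> (\<Sum>k<K. (\<integral>\<omega>. gap f g xstar (x k \<omega>) * proportion L M f g (S k \<omega>) (x k \<omega>) \<partial>P)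
                   / (\<integral>\<omega>. gap f g xstar (x k \<omega>) \<partial>P))"
  shows "(\<exists>k<K. \<not> (AE \<omega> in P. \<not> lam L f g (x k \<omega>) < \<epsilon>))
       \<or> (\<integral>\<omega>. gap f g xstar (x K \<omega>) \<partial>P) \<le> \<epsilon>"
proof (rule disjCI)
  interpret prob_space P by (rule P_prob)
  assume "\<not> expectation (\<lambda>\<omega>. gap f g xstar (x K \<omega>)) \<le> \<epsilon>"
  \<comment> \<open>The negated first alternative says that \<open>lam\<close> is at least
    \<open>\<epsilon>\<close> almost surely at each \<open>k < K\<close>; phrasing it through
    \<open>AE\<close> avoids asking for a measurable event.\<close>
  moreover have "expectation (\<lambda>\<omega>. gap f g xstar (x K \<omega>)) \<le> \<epsilon>"
    if no_small: "\<not> (\<exists>k<K. \<not> (AE \<omega> in P. \<not> lam L f g (x k \<omega>) < \<epsilon>))"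
  proof -
    have dom0: "\<bar>g i (x0 $ i)\<bar> \<noteq> \<infinity>" for i
      using x0_dom ereal_sum_less_infinity_iff[of UNIV "\<lambda>i. g i (x0 $ i)"] g_values
      by (auto simp: separable_sum_def)
    \<comment> \<open>Bounded below by assumption, and above by the finite value at
      \<open>x0\<close>.\<close>
    have xstar_fin: "\<bar>objective f g xstar\<bar> \<noteq> \<infinity>"
    proof -
      have "objective f g xstar \<le> objective f g x0"
        using xstar_min by (auto simp: is_arg_min_def not_less)
      then show ?thesis
        using objective_finite[of g x0 f] dom0 xstar_bounded by auto
    qed
    have x_start: "x 0 \<omega> = x0" if "\<omega> \<in> space P" for \<omega>
      using algorithm[OF that] by (simp add: pabd_run_def)
    have x_next: "x (Suc k) \<omega> = x k \<omega> + block_vec (S k \<omega>) (u k \<omega>)"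
      and u_min: "is_arg_min (block_model M f g (S k \<omega>) (x k \<omega>)) (\<lambda>_. True) (u k \<omega>)"
      if "k < K" "\<omega> \<in> space P" for k \<omega>
      using algorithm[OF that(2)] that(1) by (auto simp: pabd_run_def)
    have dom: "\<bar>g i (x k \<omega> $ i)\<bar> \<noteq> \<infinity>" if "k \<le> K" "\<omega> \<in> space P" for k \<omega> i
      using that(1)
    proof (induction k arbitrary: i)
      case 0
      then show ?case using dom0 x_start that(2) by simp
    next
      case (Suc k)
      then have k: "k < K" by simp
      show ?case
        unfolding x_next[OF k that(2)]
        by (rule block_step(1)[OF M_smooth g_values _ u_min[OF k that(2)]]) (use Suc in simp)
    qed
    \<comment> \<open>The negative of this minimum is the numerator of
      \<open>proportion\<close>.\<close>
    define m where
      "m k \<omega> = real_of_ereal (INF v. block_model M f g (S k \<omega>) (x k \<omega>) v)" for k \<omega>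
    have m_nonpos: "m k \<omega> \<le> 0"
      and gap_step: "gap f g xstar (x (Suc k) \<omega>) \<le> gap f g xstar (x k \<omega>) + m k \<omega>"
      if k: "k < K" and \<omega>: "\<omega> \<in> space P" for k \<omega>
    proof -
      have dom_k: "\<bar>g i (x k \<omega> $ i)\<bar> \<noteq> \<infinity>" "\<bar>g i (x (Suc k) \<omega> $ i)\<bar> \<noteq> \<infinity>" for i
        using dom[of k \<omega> i] dom[of "Suc k" \<omega> i] k \<omega> by auto
      note block = block_step[OF M_smooth g_values dom_k(1) u_min[OF k \<omega>]]
      show "m k \<omega> \<le> 0" using block(2) by (simp add: m_def)
      show "gap f g xstar (x (Suc k) \<omega>) \<le> gap f g xstar (x k \<omega>) + m k \<omega>"
        using block(3) gap_finite[OF dom_k(1) xstar_fin] gap_finite[OF dom_k(2) xstar_fin]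
        by (simp add: m_def x_next[OF k \<omega>])
    qed
    show ?thesis
    proof (rule expected_gap_bound)
      fix k assume k: "k < K"
      have "AE \<omega> in P. \<not> lam L f g (x k \<omega>) < \<epsilon>" using no_small k by blast
      then show "AE \<omega> in P. 0 \<le> proportion L M f g (S k \<omega>) (x k \<omega>) \<and>
          gap f g xstar (x (Suc k) \<omega>)
          \<le> gap f g xstar (x k \<omega>) - \<epsilon> * proportion L M f g (S k \<omega>) (x k \<omega>)"
        using AE_space
      proof eventually_elim
        case (elim \<omega>)
        let ?l = "lam L f g (x k \<omega>)" and ?\<theta> = "proportion L M f g (S k \<omega>) (x k \<omega>)"
        \<comment> \<open>A positive \<open>lam\<close> selects the quotient branch of
          \<open>proportion\<close>, so the decrease \<open>- m k \<omega>\<close> equals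
          \<open>?l * ?\<theta>\<close>, which is at least
          \<open>\<epsilon> * ?\<theta>\<close>.\<close>
        have l: "\<epsilon> \<le> ?l" "0 < ?l" using elim eps_pos by auto
        have \<theta>: "?\<theta> = - m k \<omega> / ?l" using l by (simp add: proportion_def m_def)
        then have \<theta>_nonneg: "0 \<le> ?\<theta>" using m_nonpos[OF k] elim l by (simp add: divide_nonpos_pos)
        then have "\<epsilon> * ?\<theta> \<le> ?l * ?\<theta>" using l by (intro mult_right_mono)
        also have "\<dots> = - m k \<omega>" using \<theta> l by simp
        finally show ?case using gap_step[OF k] \<theta>_nonneg elim by fastforce
      qed
    next
      fix k \<omega> assume "k < K" "\<omega> \<in> space P"
      then show "gap f g xstar (x (Suc k) \<omega>) \<le> gap f g xstar (x k \<omega>)"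
        using m_nonpos gap_step by force
    qed (use x_start gap_random gap_proportion_random gap_nonneg[OF dom xstar_fin xstar_min]
        eps_pos budget in auto)
  qed
  ultimately show "\<exists>k<K. \<not> (AE \<omega> in P. \<not> lam L f g (x k \<omega>) < \<epsilon>)" by blast
qed

end
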